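(* Let $n\ge 0$ be an integer, let $\nu\in\mathbb{R}$, and let $t\in\mathbb{C}$ with $\Re t>0$. Then $$\frac{\partial^{n}}{\partial\nu^{n}}K_{\nu}(t)=\frac{1}{2}\int_{0}^{\infty}x^{n}e^{-t\cosh x}\left[e^{\nu x}+(-1)^{n}e^{-\nu x}\right]dx=\frac{1}{2}\int_{-\infty}^{\infty}x^{n}e^{\nu x-t\cosh x}\,dx .$$
   Context: $I_\nu(t)=\sum_{k=0}^{\infty}\frac{1}{k!\,\Gamma(k+\nu+1)}\left(\frac{t}{2}\right)^{2k+\nu}$ is the modified Bessel function of the first kind (principal branch, $-\pi<\arg t\le\pi$; $1/\Gamma$ is zero at the poles of $\Gamma$), and $K_\nu(t)=\frac{\pi}{2}\,\frac{I_{-\nu}(t)-I_\nu(t)}{\sin\pi\nu}$ (for integer $\nu$, the limit in $\nu$) is the modified Bessel function of the second kind (Macdonald function). *)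

theory Defs
  imports "HOL-Analysis.Analysis"
begin

(* rGamma is the entire function 1/Gamma (zero at the poles of Gamma); powr is the principal
   branch, with -pi < Im (Ln z) <= pi. Intended for t \<noteq> 0, since 0 powr z = 0 for all z. *)
definition bessel_I :: "complex \<Rightarrow> complex \<Rightarrow> complex" where
  "bessel_I \<nu> t =
     (\<Sum>k. rGamma (of_nat k + \<nu> + 1) / fact k * (t / 2) powr (2 * of_nat k + \<nu>))"

definition bessel_K :: "complex \<Rightarrow> complex \<Rightarrow> complex" where
  "bessel_K \<nu> t =
     (let q = (\<lambda>\<mu>. of_real pi / 2 * ((bessel_I (- \<mu>) t - bessel_I \<mu> t) / sin (of_real pi * \<mu>)))
      in if \<nu> \<in> \<int> then Lim (at \<nu>) q else q \<nu>)"

(* vector_derivative is an unspecified value where the derivative does not exist, so this is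
   meaningful only together with differentiability of the lower-order derivatives. *)
definition iter_vector_derivative ::
    "nat \<Rightarrow> (real \<Rightarrow> 'a::real_normed_vector) \<Rightarrow> real \<Rightarrow> 'a" where
  "iter_vector_derivative n f = ((\<lambda>g x. vector_derivative g (at x)) ^^ n) f"

end

theory Submission
  imports Defs "HOL-Complex_Analysis.Complex_Analysis" "HOL-Real_Asymp.Real_Asymp"
begin

text \<open>
  Put \<open>w = t / 2\<close>, so that \<open>t cosh x = w e\<^sup>x + w e\<^sup>-\<^sup>x\<close>, and let \<open>h(\<nu>)\<close> be the integral of
  \<open>exp (- \<nu> x - t cosh x)\<close> over the positive half-line; the integral of \<open>exp (\<nu> x - t cosh x)\<close>
  over the real line is \<open>h(\<nu>) + h(-\<nu>)\<close>. Expanding \<open>exp (- w e\<^sup>-\<^sup>x)\<close> as a power series turns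
  \<open>h(\<nu>)\<close> into a series of incomplete Gamma integrals
  \<open>\<integral>\<^sub>0\<^sup>\<infinity> exp (- (\<nu> + k) x - w e\<^sup>x) dx = w\<^sup>\<nu>\<^sup>+\<^sup>k \<Gamma>(-\<nu>-k) - \<Sum>\<^sub>j (-w)\<^sup>j / (j! (j - k - \<nu>))\<close>.
  By the reflection formula the Gamma terms add up to \<open>- \<pi> / sin (\<pi> \<nu>) I\<^sub>\<nu>(t)\<close>, and the
  remaining double series changes sign when \<open>\<nu>\<close> becomes \<open>-\<nu>\<close> and \<open>j, k\<close> are exchanged, hence
  cancels in \<open>h(\<nu>) + h(-\<nu>)\<close>. Integer \<open>\<nu>\<close> follow by continuity of the integral in \<open>\<nu>\<close>, and
  the derivatives by differentiating under the integral sign.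
\<close>

section \<open>Differentiation under the integral sign and integrals over half-lines\<close>

text \<open>The estimate |e^z - 1 - z| \<le> |z|^2 e^|z| with z = h G(x) bounds the error of the
  difference quotient by |h| times the integral of the function in \<open>int2\<close>. The lemma
  serves both for the parameter w, with G(x) = - exp x, and for the order \<nu>, with G(x) =
  x.\<close>

lemma has_field_derivative_integral_exp_mult:
  fixes F :: "'a \<Rightarrow> complex" and G :: "'a \<Rightarrow> real" and p :: complex
  assumes "\<delta> > 0"
    and int: "\<And>q. q \<in> ball p \<delta> \<Longrightarrow> integrable M (\<lambda>x. F x * exp (q * of_real (G x)))"
    and int1: "integrable M (\<lambda>x. of_real (G x) * (F x * exp (p * of_real (G x))))"
    and int2: "integrable M (\<lambda>x. norm (F x * exp (p * of_real (G x))) * (exp (\<delta> * \<bar>G x\<bar>) * (G x)\<^sup>2))"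
  shows "((\<lambda>q. LINT x|M. F x * exp (q * of_real (G x))) has_field_derivative
           (LINT x|M. of_real (G x) * (F x * exp (p * of_real (G x))))) (at p)"
proof -
  let ?I = "\<lambda>q. LINT x|M. F x * exp (q * of_real (G x))"
  let ?D = "LINT x|M. of_real (G x) * (F x * exp (p * of_real (G x)))"
  let ?C = "LINT x|M. norm (F x * exp (p * of_real (G x))) * (exp (\<delta> * \<bar>G x\<bar>) * (G x)\<^sup>2)"
  have bound: "norm ((?I (p + h) - ?I p) / h - ?D) \<le> ?C * norm h" if h: "h \<noteq> 0" "norm h < \<delta>" for h
  proof -
    have p: "p \<in> ball p \<delta>" "p + h \<in> ball p \<delta>" using h \<open>\<delta> > 0\<close> by (auto simp: dist_norm)
    have i1: "integrable M (\<lambda>x. F x * exp ((p + h) * of_real (G x)) - F x * exp (p * of_real (G x))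
        - h * (of_real (G x) * (F x * exp (p * of_real (G x)))))"
      using int[OF p(1)] int[OF p(2)] int1 by auto
    have "?I (p + h) - ?I p - h * ?D = (LINT x|M. F x * exp ((p + h) * of_real (G x))
        - F x * exp (p * of_real (G x)) - h * (of_real (G x) * (F x * exp (p * of_real (G x)))))"
      using int[OF p(1)] int[OF p(2)] int1 by simp
    also have "norm \<dots> \<le> (LINT x|M. (norm h)\<^sup>2 * (norm (F x * exp (p * of_real (G x))) *
        (exp (\<delta> * \<bar>G x\<bar>) * (G x)\<^sup>2)))"
    proof (rule order_trans[OF integral_norm_bound], rule integral_mono)
      fix x
      let ?z = "h * of_real (G x)"
      have "norm (exp ?z - 1 - ?z) \<le> exp (norm ?z) * (norm ?z)\<^sup>2"
        using Taylor_exp_field[of ?z 1] by (simp add: power2_eq_square algebra_simps)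
      also have "\<dots> \<le> exp (\<delta> * \<bar>G x\<bar>) * (norm ?z)\<^sup>2"
        using h by (intro mult_right_mono) (auto simp: norm_mult intro!: mult_right_mono)
      finally have *: "norm (exp ?z - 1 - ?z) \<le> exp (\<delta> * \<bar>G x\<bar>) * (norm ?z)\<^sup>2" .
      have "F x * exp ((p + h) * of_real (G x)) - F x * exp (p * of_real (G x))
          - h * (of_real (G x) * (F x * exp (p * of_real (G x))))
        = (F x * exp (p * of_real (G x))) * (exp ?z - 1 - ?z)"
        by (simp add: algebra_simps exp_add)
      also have "norm \<dots> \<le> norm (F x * exp (p * of_real (G x))) * (exp (\<delta> * \<bar>G x\<bar>) * (norm ?z)\<^sup>2)"
        unfolding norm_mult[of "F x * exp (p * of_real (G x))"] by (intro mult_left_mono * norm_ge_zero)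
      also have "\<dots> = (norm h)\<^sup>2 * (norm (F x * exp (p * of_real (G x))) *
        (exp (\<delta> * \<bar>G x\<bar>) * (G x)\<^sup>2))"
        by (simp add: norm_mult power_mult_distrib algebra_simps)
      finally show "norm (F x * exp ((p + h) * of_real (G x)) - F x * exp (p * of_real (G x))
          - h * (of_real (G x) * (F x * exp (p * of_real (G x))))) \<le> \<dots>" .
    qed (use i1 int2 in auto)
    also have "\<dots> = (norm h)\<^sup>2 * ?C" by simp
    finally have "norm (?I (p + h) - ?I p - h * ?D) \<le> (norm h)\<^sup>2 * ?C" .
    moreover have "(?I (p + h) - ?I p) / h - ?D = (?I (p + h) - ?I p - h * ?D) / h"
      using h by (simp add: field_simps)
    ultimately show ?thesis
      using h by (simp add: norm_divide divide_le_eq power2_eq_square mult_ac)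
  qed
  show ?thesis
    unfolding DERIV_def
  proof (rule LIM_zero_cancel, rule Lim_null_comparison)
    show "\<forall>\<^sub>F h in at 0. norm ((?I (p + h) - ?I p) / h - ?D) \<le> ?C * norm h"
      unfolding eventually_at using \<open>\<delta> > 0\<close> bound by (intro exI[of _ \<delta>]) auto
    show "(\<lambda>h. ?C * norm h) \<midarrow>0\<rightarrow> 0" by (auto intro!: tendsto_eq_intros)
  qed
qed

lemma integral_eq_half_line:
  fixes f :: "real \<Rightarrow> 'a::{banach, second_countable_topology}"
  assumes f: "integrable lborel f"
  shows "(LBINT x. f x) = (LBINT x:{0<..}. f x) + (LBINT x:{0<..}. f (- x))"
proof -
  have [measurable]: "f \<in> borel_measurable borel" using f by auto
  have "(LBINT x. f x) = (LBINT x. indicator {0<..} x *\<^sub>R f x + indicator {..<0} x *\<^sub>R f x)"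
    by (rule integral_cong_AE) 
       (use AE_lborel_singleton[of 0] in \<open>auto elim!: eventually_mono split: split_indicator\<close>)
  also have "\<dots> = (LBINT x:{0<..}. f x) + (LBINT x:{..<0}. f x)"
    unfolding set_lebesgue_integral_def
    by (intro Bochner_Integration.integral_add integrable_mult_indicator f) auto
  also have "(LBINT x:{..<0}. f x) = (LBINT x:{0<..}. f (- x))"
    by (subst set_integral_reflect) (simp add: greaterThan_def)
  finally show ?thesis .
qed

lemma integral_FTC_greaterThan:
  fixes f F :: "real \<Rightarrow> 'a::euclidean_space"
  assumes "\<And>x. (F has_vector_derivative f x) (at x)" and "\<And>x. isCont f x"
    and "set_integrable lborel {a<..} f" and "(F \<longlongrightarrow> B) at_top"
  shows "(LBINT x:{a<..}. f x) = B - F a"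
proof -
  have "(LBINT x=ereal a..\<infinity>. f x) = B - F a"
  proof (rule interval_integral_FTC_integrable[where F = F])
    show "((F \<circ> real_of_ereal) \<longlongrightarrow> F a) (at_right (ereal a))"
      using has_vector_derivative_continuous[OF assms(1)]
      by (simp add: ereal_tendsto_simps continuous_within isCont_def filterlim_at_split)
    show "((F \<circ> real_of_ereal) \<longlongrightarrow> B) (at_left \<infinity>)"
      using assms(4) by (simp add: ereal_tendsto_simps)
  qed (use assms in auto)
  then show ?thesis
    by (simp add: interval_integral_to_infinity_eq)
qed

section \<open>Euler's Gamma integral in the exponential variable\<close>

text \<open>Borel measurability of the integrand, \<open>m\<close>, brings Euler's integral down
  from the completed measure to \<open>lborel\<close>, the measure of all later integrals.\<close>

lemma
  fixes s :: complex
  assumes "Re s > 0"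
  shows set_integrable_Gamma: "r > 0 \<Longrightarrow> set_integrable lborel {0<..}
           (\<lambda>u. of_real u powr (s - 1) / of_real (exp (r * u)))"
    and set_integral_Gamma: "(LBINT u:{0<..}. of_real u powr (s - 1) / of_real (exp u)) = Gamma s"
proof -
  have m: "(\<lambda>u. indicator {0<..} u *\<^sub>R (of_real u powr (s - 1) / complex_of_real (exp (r * u))))
      \<in> borel_measurable borel" for r :: real
    by (intro borel_measurable_continuous_on_indicator) (auto intro!: continuous_intros simp: complex_nonpos_Reals_iff)
  show *: "set_integrable lborel {0<..} (\<lambda>u. of_real u powr (s - 1) / complex_of_real (exp (r * u)))"
    if "r > 0" for r
    using absolutely_integrable_Gamma_integral[OF assms that] m[of r]
    by (simp add: set_integrable_def integrable_completion)
  show "(LBINT u:{0<..}. of_real u powr (s - 1) / of_real (exp u)) = Gamma s"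
  proof -
    have "((\<lambda>u. complex_of_real u powr (s - 1) / of_real (exp u)) has_integral
            (LBINT u:{0<..}. of_real u powr (s - 1) / of_real (exp u))) {0<..}"
      using has_integral_set_lebesgue[of "{0<..}" "\<lambda>u. complex_of_real u powr (s - 1) / of_real (exp u)"]
        absolutely_integrable_Gamma_integral'[OF assms] m[of 1]
      by (simp add: set_lebesgue_integral_def integral_completion)
    then show ?thesis
      using Gamma_integral_complex'[OF assms] has_integral_unique by blast
  qed
qed

lemma integrable_exp_minus_exp_real:
  fixes \<sigma> r :: real
  assumes "\<sigma> > 0" "r > 0"
  shows "integrable lborel (\<lambda>x. exp (\<sigma> * x - r * exp x))"
proof -
  have "set_integrable lborel (einterval (-\<infinity>) \<infinity>) (\<lambda>x. exp (\<sigma> * x - r * exp x))"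
  \<comment> \<open>The substitution u = exp x, read through g = ln from (0, \<infinity>) onto the
    line, leads to u^(\<sigma>-1) exp (- r u). The version for nonnegative integrands also yields
    integrability on the line.\<close>
  proof (rule interval_integral_substitution_nonneg(1)[where a = 0 and b = \<infinity> and g = ln and g' = "\<lambda>u. 1 / u"])
    have "set_integrable lborel {0<..} (\<lambda>u. norm (of_real u powr (of_real \<sigma> - 1) / complex_of_real (exp (r * u))))"
      using set_integrable_Gamma[of "of_real \<sigma>" r] assms by (intro set_integrable_norm) auto
    also have "?this \<longleftrightarrow> set_integrable lborel {0<..} (\<lambda>u. exp (\<sigma> * ln u - r * exp (ln u)) * (1 / u))"
      by (rule set_integrable_cong)
        (auto simp: norm_mult norm_divide norm_powr_real_powr powr_def exp_diff field_simps)
    finally show "set_integrable lborel (einterval 0 \<infinity>) (\<lambda>u. exp (\<sigma> * ln u - r * exp (ln u)) * (1 / u))"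
      by (simp add: einterval_def greaterThan_def)
    show "((ereal \<circ> ln \<circ> real_of_ereal) \<longlongrightarrow> - \<infinity>) (at_right 0)"
      by (simp add: zero_ereal_def ereal_tendsto_simps ln_at_0 flip: o_def)
    show "((ereal \<circ> ln \<circ> real_of_ereal) \<longlongrightarrow> \<infinity>) (at_left \<infinity>)"
      by (simp add: ereal_tendsto_simps ln_at_top)
  qed (auto intro!: derivative_eq_intros continuous_intros simp: zero_ereal_def)
  then show ?thesis
    by (simp add: set_integrable_def einterval_def)
qed

lemma integrable_exp_minus_exp:
  fixes s w :: complex
  assumes "Re s > 0" "Re w > 0"
  shows "integrable lborel (\<lambda>x. exp (s * of_real x - w * of_real (exp x)))"
  by (rule Bochner_Integration.integrable_bound[OF integrable_exp_minus_exp_real[OF assms]]) auto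

text \<open>On x > 0 the exponent c x is at most (|c| + 1) x, whose rate is positive, so the
  integrand over the whole line serves as majorant. Admitting every real c is what later permits the
  shifts \<nu> + k.\<close>

lemma set_integrable_exp_minus_exp_real:
  fixes c r :: real
  assumes "r > 0"
  shows "set_integrable lborel {0<..} (\<lambda>x. exp (c * x - r * exp x))"
  unfolding set_integrable_def
proof (rule Bochner_Integration.integrable_bound[OF integrable_exp_minus_exp_real[of "\<bar>c\<bar> + 1" r]])
  have "c * x \<le> (\<bar>c\<bar> + 1) * x" if "x > 0" for x
    using that by (intro mult_right_mono) auto
  then show "AE x in lborel. norm (indicator {0<..} x *\<^sub>R exp (c * x - r * exp x))
      \<le> norm (exp ((\<bar>c\<bar> + 1) * x - r * exp x))"
    by (auto split: split_indicator)
qed (use assms in auto)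

lemma set_integrable_exp_minus_exp:
  fixes s w :: complex
  assumes "Re w > 0"
  shows "set_integrable lborel {0<..} (\<lambda>x. exp (s * of_real x - w * of_real (exp x)))"
  by (rule set_integrable_bound[OF set_integrable_exp_minus_exp_real[OF assms, of "Re s"]])
    (auto simp: set_borel_measurable_def)

lemma integral_exp_minus_exp_real:
  fixes s :: complex and r :: real
  assumes s: "Re s > 0" and r: "r > 0"
  shows "(LBINT x. exp (s * of_real x - of_real r * of_real (exp x))) = of_real r powr (- s) * Gamma s"
proof -
  have "(LBINT x=-\<infinity>..\<infinity>. exp (s * of_real x - of_real (exp x)))
      = (LBINT u=0..\<infinity>. (1 / u) *\<^sub>R exp (s * of_real (ln u) - of_real (exp (ln u))))"
  proof (rule interval_integral_substitution_integrable)
    have "set_integrable lborel {0<..} (\<lambda>u. of_real u powr (s - 1) / complex_of_real (exp u))"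
      using set_integrable_Gamma[of s 1] s by simp
    also have "?this \<longleftrightarrow> set_integrable lborel {0<..}
        (\<lambda>u. (1 / u) *\<^sub>R exp (s * of_real (ln u) - of_real (exp (ln u))))"
      by (rule set_integrable_cong)
        (auto simp: powr_def exp_diff scaleR_conv_of_real Ln_of_real exp_of_real field_simps)
    finally show "set_integrable lborel (einterval 0 \<infinity>)
        (\<lambda>u. (1 / u) *\<^sub>R exp (s * of_real (ln u) - of_real (exp (ln u))))"
      by (simp add: einterval_def greaterThan_def)
    show "set_integrable lborel (einterval (- \<infinity>) \<infinity>) (\<lambda>x. exp (s * of_real x - of_real (exp x)))"
      using integrable_exp_minus_exp[OF s, of 1] by (simp add: set_integrable_def einterval_def)
    show "((ereal \<circ> ln \<circ> real_of_ereal) \<longlongrightarrow> - \<infinity>) (at_right 0)"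
      by (simp add: zero_ereal_def ereal_tendsto_simps ln_at_0 flip: o_def)
    show "((ereal \<circ> ln \<circ> real_of_ereal) \<longlongrightarrow> \<infinity>) (at_left \<infinity>)"
      by (simp add: ereal_tendsto_simps ln_at_top)
  qed (auto intro!: derivative_eq_intros continuous_intros simp: zero_ereal_def)
  also have "\<dots> = (LBINT u:{0<..}. (1 / u) *\<^sub>R exp (s * of_real (ln u) - of_real (exp (ln u))))"
    by (simp add: zero_ereal_def interval_integral_to_infinity_eq)
  also have "\<dots> = (LBINT u:{0<..}. of_real u powr (s - 1) / of_real (exp u))"
    by (rule set_lebesgue_integral_cong)
      (auto simp: powr_def exp_diff scaleR_conv_of_real Ln_of_real exp_of_real field_simps)
  finally have 1: "(LBINT x. exp (s * of_real x - of_real (exp x))) = Gamma s"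
    using set_integral_Gamma[OF s] by (simp add: interval_lebesgue_integral_def set_lebesgue_integral_def einterval_def)
  \<comment> \<open>Translating x by - ln r turns r exp x into exp x and pulls out exp (- s ln r),
    the factor r^(-s).\<close>
  have "(LBINT x. exp (s * of_real x - of_real r * of_real (exp x)))
      = (LBINT x. exp (s * of_real (- ln r + x) - of_real r * of_real (exp (- ln r + x))))"
    by (subst lborel_integral_real_affine[where c = 1 and t = "- ln r"]) auto
  also have "\<dots> = (LBINT x. of_real r powr (- s) * exp (s * of_real x - of_real (exp x)))"
    using r by (intro Bochner_Integration.integral_cong refl)
      (auto simp: powr_def Ln_of_real exp_diff exp_minus exp_add algebra_simps field_simps)
  finally show ?thesis using 1 by simp
qed

text \<open>Both sides are holomorphic in w on the right half-plane and agree on the positive reals,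
  so the identity theorem applies.\<close>

lemma integral_exp_minus_exp:
  fixes s w :: complex
  assumes s: "Re s > 0" and w: "Re w > 0"
  shows "(LBINT x. exp (s * of_real x - w * of_real (exp x))) = w powr (- s) * Gamma s"
proof -
  define S where "S = {z. Re z > 0}"
  let ?f = "\<lambda>w. LBINT x. exp (s * of_real x) * exp (w * of_real (- exp x))"
  have eq: "exp (s * of_real x) * exp (w * of_real (- exp x)) = exp (s * of_real x - w * of_real (exp x))"
    for w and x :: real
    by (simp add: exp_diff exp_minus field_simps)
  have deriv: "\<exists>D. (?f has_field_derivative D) (at w)" if "w \<in> S" for w
  proof (intro exI, rule has_field_derivative_integral_exp_mult)
    \<comment> \<open>With half of Re w the ball stays in the right half-plane, and the factor exp
      (\<delta> exp x) of the second-order bound uses up only half of the decay of exp (- Re w exp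
      x).\<close>
    define \<delta> where "\<delta> = Re w / 2"
    show "\<delta> > 0" using that by (simp add: \<delta>_def S_def)
    show "integrable lborel (\<lambda>x. exp (s * of_real x) * exp (q * of_real (- exp x)))"
      if "q \<in> ball w \<delta>" for q
      unfolding eq
    proof (rule integrable_exp_minus_exp[OF s])
      have "\<bar>Re (w - q)\<bar> < \<delta>"
        using that abs_Re_le_cmod[of "w - q"] by (simp add: dist_norm)
      then show "Re q > 0" using \<open>\<delta> > 0\<close> unfolding \<delta>_def minus_complex.sel by linarith
    qed
    have "integrable lborel (\<lambda>x. - exp ((s + 1) * of_real x - w * of_real (exp x)))"
      using that s by (intro Bochner_Integration.integrable_minus integrable_exp_minus_exp) (auto simp: S_def)
    also have "(\<lambda>x. - exp ((s + 1) * of_real x - w * of_real (exp x)))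
      = (\<lambda>x. of_real (- exp x) * (exp (s * of_real x) * exp (w * of_real (- exp x))))"
      unfolding eq by (simp add: fun_eq_iff exp_diff exp_add exp_of_real algebra_simps)
    finally show "integrable lborel \<dots>" .
    \<comment> \<open>The 2 added to Re s comes from the square of G(x) = - exp x.\<close>
    have "integrable lborel (\<lambda>x. exp ((Re s + 2) * x - (Re w / 2) * exp x))"
      using that s by (intro integrable_exp_minus_exp_real) (auto simp: S_def)
    also have "(\<lambda>x. exp ((Re s + 2) * x - (Re w / 2) * exp x))
      = (\<lambda>x. norm (exp (s * of_real x) * exp (w * of_real (- exp x))) *
           (exp (\<delta> * \<bar>- exp x\<bar>) * (- exp x)\<^sup>2))"
      unfolding eq \<delta>_def
      by (simp add: fun_eq_iff exp_double power2_eq_square algebra_simps flip: exp_add)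
    finally show "integrable lborel \<dots>" .
  qed
  have "?f w - w powr (- s) * Gamma s = 0"
  proof (rule analytic_continuation[where S = S and U = "of_real ` {0<..}" and \<xi> = 1
        and f = "\<lambda>w. ?f w - w powr (- s) * Gamma s"])
    show "open S" "connected S"
      by (auto simp: S_def open_halfspace_Re_gt convex_halfspace_Re_gt intro: convex_connected)
    have "S \<inter> \<real>\<^sub>\<le>\<^sub>0 = {}" by (auto simp: S_def complex_nonpos_Reals_iff)
    moreover have "?f holomorphic_on S"
      using deriv \<open>open S\<close> by (auto simp: holomorphic_on_open)
    ultimately show "(\<lambda>w. ?f w - w powr (- s) * Gamma s) holomorphic_on S"
      by (intro holomorphic_intros) auto
    show "?f z - z powr (- s) * Gamma s = 0" if z: "z \<in> of_real ` {0<..}" for z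
    proof -
      obtain r where "r > 0" "z = of_real r" using z by auto
      then show ?thesis
        unfolding eq using integral_exp_minus_exp_real[OF s, of r] by simp
    qed
    show "(1::complex) islimpt of_real ` {0<..}"
      unfolding islimpt_approachable
    proof (intro allI impI)
      fix e :: real assume "e > 0"
      then show "\<exists>x'\<in>of_real ` {0<..}. x' \<noteq> (1::complex) \<and> dist x' 1 < e"
        by (intro bexI[of _ "of_real (1 + e / 2)"] conjI imageI) (auto simp: dist_norm)
    qed
  qed (use w in \<open>auto simp: S_def\<close>)
  then show ?thesis unfolding eq by simp
qed

section \<open>Integrals over the line with the kernel exp (- t cosh x)\<close>

text \<open>Since cosh x \<ge> exp |x| / 2 and |x|^n \<le> n! exp |x|, the integrand is at most n!
  P(|x|), hence at most n! (P(x) + P(-x)). The 1 added to |c| in P pays for the power of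
  |x|.\<close>

lemma integrable_abs_power_exp_cosh:
  fixes c r :: real
  assumes "r > 0"
  shows "integrable lborel (\<lambda>x. \<bar>x\<bar> ^ n * exp (c * \<bar>x\<bar> - r * cosh x))"
proof (rule Bochner_Integration.integrable_bound)
  let ?P = "\<lambda>x::real. exp ((\<bar>c\<bar> + 1) * x - r / 2 * exp x)"
  have P: "integrable lborel ?P"
    using assms by (intro integrable_exp_minus_exp_real) auto
  then have "integrable lborel (\<lambda>x. ?P (- x))"
    using lborel_integrable_real_affine[of ?P "-1" 0] by simp
  with P show "integrable lborel (\<lambda>x. fact n * (?P x + ?P (- x)))"
    by (intro integrable_mult_right Bochner_Integration.integrable_add)
  show "AE x in lborel. norm (\<bar>x\<bar> ^ n * exp (c * \<bar>x\<bar> - r * cosh x)) \<le> norm (fact n * (?P x + ?P (- x)))"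
  proof (rule AE_I2)
    fix x :: real
    \<comment> \<open>A single term of the exponential series is at most the whole sum.\<close>
    have 1: "\<bar>x\<bar> ^ n \<le> fact n * exp \<bar>x\<bar>"
      using sum_le_suminf[of "\<lambda>k. \<bar>x\<bar> ^ k /\<^sub>R fact k" "{n}"] summable_exp_generic[of "\<bar>x\<bar>"]
      by (simp add: exp_def field_simps)
    have "c * \<bar>x\<bar> \<le> \<bar>c\<bar> * \<bar>x\<bar>" by (intro mult_right_mono) auto
    moreover have "r * (exp \<bar>x\<bar> / 2) \<le> r * cosh x"
      using assms by (intro mult_left_mono) (auto simp: cosh_def abs_if)
    ultimately have "exp (c * \<bar>x\<bar> - r * cosh x) \<le> exp (\<bar>c\<bar> * \<bar>x\<bar> - r / 2 * exp \<bar>x\<bar>)"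
      by simp
    from mult_mono[OF 1 this]
    have "\<bar>x\<bar> ^ n * exp (c * \<bar>x\<bar> - r * cosh x) \<le> fact n * ?P \<bar>x\<bar>"
      by (simp add: algebra_simps flip: exp_add)
    also have "\<dots> \<le> fact n * (?P x + ?P (- x))"
      by (intro mult_left_mono) (auto simp: abs_if)
    finally show "norm (\<bar>x\<bar> ^ n * exp (c * \<bar>x\<bar> - r * cosh x)) \<le> norm (fact n * (?P x + ?P (- x)))"
      by (simp add: abs_mult power_abs)
  qed
qed (auto intro!: borel_measurable_continuous_onI continuous_intros)

lemma integrable_power_exp_cosh:
  fixes \<nu> t :: complex
  assumes "Re t > 0"
  shows "integrable lborel (\<lambda>x. of_real (x ^ n) * exp (\<nu> * of_real x - t * of_real (cosh x)))"
proof (rule Bochner_Integration.integrable_bound[OF integrable_abs_power_exp_cosh[OF assms, of n "\<bar>Re \<nu>\<bar>"]])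
  have "Re \<nu> * x \<le> \<bar>Re \<nu>\<bar> * \<bar>x\<bar>" for x
    by (metis abs_le_D1 abs_mult order_refl)
  then show "AE x in lborel. norm (of_real (x ^ n) * exp (\<nu> * of_real x - t * of_real (cosh x)))
      \<le> norm (\<bar>x\<bar> ^ n * exp (\<bar>Re \<nu>\<bar> * \<bar>x\<bar> - Re t * cosh x))"
    by (intro AE_I2) (auto simp: norm_mult norm_power abs_mult power_abs intro!: mult_left_mono)
qed (auto intro!: borel_measurable_continuous_onI continuous_intros)

text \<open>Complex differentiability in \<nu> serves twice: restricted to real orders it gives the
  derivatives of K, and as continuity it gives access to the integer orders.\<close>

lemma has_field_derivative_integral_power_exp_cosh:
  fixes \<nu> t :: complex
  assumes t: "Re t > 0"
  shows "((\<lambda>\<nu>. LBINT x. of_real (x ^ n) * exp (\<nu> * of_real x - t * of_real (cosh x))) has_field_derivative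
           (LBINT x. of_real (x ^ Suc n) * exp (\<nu> * of_real x - t * of_real (cosh x)))) (at \<nu>)"
proof -
  let ?F = "\<lambda>x. complex_of_real (x ^ n) * exp (- t * of_real (cosh x))"
  have eq: "?F x * exp (q * of_real x) = of_real (x ^ n) * exp (q * of_real x - t * of_real (cosh x))" for q x
    by (simp add: exp_diff exp_minus field_simps)
  have eq': "of_real x * (?F x * exp (q * of_real x))
      = of_real (x ^ Suc n) * exp (q * of_real x - t * of_real (cosh x))" for q x
    unfolding eq by simp
  have "((\<lambda>q. LBINT x. ?F x * exp (q * of_real x)) has_field_derivative
           (LBINT x. of_real x * (?F x * exp (\<nu> * of_real x)))) (at \<nu>)"
  proof (rule has_field_derivative_integral_exp_mult[of 1])
    show "integrable lborel (\<lambda>x. norm (?F x * exp (\<nu> * of_real x)) * (exp (1 * \<bar>x\<bar>) * x\<^sup>2))"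
    \<comment> \<open>The extra factor exp |x| x^2, for radius 1, is absorbed by raising the power
      from n to n + 2 and the exponential rate by 1.\<close>
    proof (rule Bochner_Integration.integrable_bound[OF
          integrable_abs_power_exp_cosh[OF t, of "n + 2" "\<bar>Re \<nu>\<bar> + 1"]])
      show "AE x in lborel. norm (norm (?F x * exp (\<nu> * of_real x)) * (exp (1 * \<bar>x\<bar>) * x\<^sup>2))
        \<le> norm (\<bar>x\<bar> ^ (n + 2) * exp ((\<bar>Re \<nu>\<bar> + 1) * \<bar>x\<bar> - Re t * cosh x))"
      proof (rule AE_I2)
        fix x :: real
        have "Re \<nu> * x \<le> \<bar>Re \<nu>\<bar> * \<bar>x\<bar>"
          by (metis abs_le_D1 abs_mult order_refl)
        then have "exp (Re \<nu> * x - Re t * cosh x + \<bar>x\<bar>) \<le> exp ((\<bar>Re \<nu>\<bar> + 1) * \<bar>x\<bar> - Re t * cosh x)"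
          by (simp add: algebra_simps)
        then have "\<bar>x\<bar> ^ (n + 2) * exp (Re \<nu> * x - Re t * cosh x + \<bar>x\<bar>)
            \<le> \<bar>x\<bar> ^ (n + 2) * exp ((\<bar>Re \<nu>\<bar> + 1) * \<bar>x\<bar> - Re t * cosh x)"
          by (intro mult_left_mono) auto
        then show "norm (norm (?F x * exp (\<nu> * of_real x)) * (exp (1 * \<bar>x\<bar>) * x\<^sup>2))
          \<le> norm (\<bar>x\<bar> ^ (n + 2) * exp ((\<bar>Re \<nu>\<bar> + 1) * \<bar>x\<bar> - Re t * cosh x))"
          unfolding eq by (simp add: norm_mult norm_power abs_mult power_abs exp_add power2_eq_square mult_ac)
      qed
    qed (auto intro!: borel_measurable_continuous_onI continuous_intros)
      show "integrable lborel (\<lambda>x. of_real x * (?F x * exp (\<nu> * of_real x)))"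
      unfolding eq' by (rule integrable_power_exp_cosh[OF t])
    show "integrable lborel (\<lambda>x. ?F x * exp (q * of_real x))" for q
      unfolding eq by (rule integrable_power_exp_cosh[OF t])
  qed simp
  then show ?thesis unfolding eq' unfolding eq .
qed

section \<open>Incomplete Gamma integrals and their power series\<close>

text \<open>For Re w > 0 and u = exp x this is the integral of u^(-a-1) exp (- w u) over u > 1, that
  is w^a \<Gamma>(-a, w) with the upper incomplete Gamma function.\<close>

definition exp_half_integral :: "complex \<Rightarrow> complex \<Rightarrow> complex" where
  "exp_half_integral a w = (LBINT x:{0<..}. exp (- a * of_real x - w * of_real (exp x)))"

text \<open>For Re a < 0 this is the integral of u^(-a-1) exp (- w u) over 0 < u < 1, the lower
  incomplete counterpart; the series continues it to every a outside the naturals.\<close>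

definition exp_unit_series :: "complex \<Rightarrow> complex \<Rightarrow> complex" where
  "exp_unit_series a w = (\<Sum>j. (- w) ^ j / (fact j * (of_nat j - a)))"

lemma tendsto_exp_minus_exp:
  fixes a w :: complex
  assumes "Re w > 0"
  shows "((\<lambda>x. exp (- a * of_real x - w * of_real (exp x))) \<longlongrightarrow> 0) at_top"
proof (rule tendsto_norm_zero_cancel)
  have "((\<lambda>x. exp (c * x - r * exp x)) \<longlongrightarrow> 0) at_top" if "r > 0" for c r :: real
    using that by real_asymp
  from this[OF assms, of "- Re a"]
  show "((\<lambda>x. norm (exp (- a * of_real x - w * of_real (exp x)))) \<longlongrightarrow> 0) at_top"
    by simp
qed

text \<open>The derivative of exp (- a x - w exp x) is - a times this function minus w times the one
  for a - 1. Integrated over x > 0, it leaves only the boundary value at 0.\<close>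

lemma exp_half_integral_recurrence:
  assumes "Re w > 0"
  shows "a * exp_half_integral a w + w * exp_half_integral (a - 1) w = exp (- w)"
proof -
  let ?f = "\<lambda>a x. exp (- a * of_real x - w * of_real (exp x))"
  have int: "set_integrable lborel {0<..} (?f a)" for a
    by (rule set_integrable_exp_minus_exp[OF assms])
  have "(LBINT x:{0<..}. - a * ?f a x - w * ?f (a - 1) x) = 0 - ?f a 0"
  proof (rule integral_FTC_greaterThan)
    show "(?f a has_vector_derivative - a * ?f a x - w * ?f (a - 1) x) (at x)" for x
    proof -
      have "?f (a - 1) x = exp (of_real x) * ?f a x"
        by (simp add: algebra_simps flip: exp_add)
      then have "((\<lambda>z. exp (- a * z - w * exp z)) has_field_derivative
          (- a * ?f a x - w * ?f (a - 1) x)) (at (of_real x))"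
        by (auto intro!: derivative_eq_intros simp: algebra_simps exp_of_real)
      from has_vector_derivative_real_field[OF this] show ?thesis
        by (simp add: exp_of_real)
    qed
    show "(?f a \<longlongrightarrow> 0) at_top" by (rule tendsto_exp_minus_exp[OF assms])
    show "set_integrable lborel {0<..} (\<lambda>x. - a * ?f a x - w * ?f (a - 1) x)"
      by (intro set_integral_diff set_integrable_mult_right int)
  qed (auto intro!: continuous_intros)
  also have "(LBINT x:{0<..}. - a * ?f a x - w * ?f (a - 1) x)
    = - a * exp_half_integral a w - w * exp_half_integral (a - 1) w"
    unfolding exp_half_integral_def
    by (subst set_integral_diff(2); (intro set_integrable_mult_right int)?; simp only: set_integral_mult_right)
  finally show ?thesis by (simp add: algebra_simps)
qed

text \<open>Closedness of the naturals gives one bound for all denominators j - a, so that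
  \<open>exp_unit_series\<close> can be compared with the exponential series.\<close>

lemma Nats_shift_lower_bound:
  fixes a :: complex
  assumes "a \<notin> \<nat>"
  obtains d where "d > 0" "\<And>j. d \<le> norm (of_nat j - a)"
proof -
  have "closed (\<nat> :: complex set)" by (rule closed_Nats)
  then have "\<exists>d>0. \<forall>x\<in>\<nat>. d \<le> dist a x"
    using separate_point_closed assms by blast
  then show thesis using that by (metis Nats_def dist_norm norm_minus_commute rangeI)
qed

lemma summable_exp_unit_series:
  fixes a w :: complex
  assumes "a \<notin> \<nat>"
  shows "summable (\<lambda>j. (- w) ^ j / (fact j * (of_nat j - a)))"
proof -
  obtain d where d: "d > 0" "\<And>j. d \<le> norm (of_nat j - a)"
    using Nats_shift_lower_bound[OF assms] by blast
  have *: "0 < norm (of_nat j - a)" for j using d(1) d(2)[of j] by linarith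
  show ?thesis
  proof (rule summable_comparison_test'[of "\<lambda>j. norm w ^ j /\<^sub>R fact j / d" 0])
    show "summable (\<lambda>j. norm w ^ j /\<^sub>R fact j / d)"
      by (intro summable_divide summable_exp_generic)
    show "norm ((- w) ^ j / (fact j * (of_nat j - a))) \<le> norm w ^ j /\<^sub>R fact j / d" for j
      using d(1) d(2)[of j] *[of j]
      by (auto simp: norm_divide norm_mult norm_power divide_simps intro!: mult_left_mono)
  qed
qed

text \<open>After an index shift, - w times the series for a - 1 has terms with the factor j / (j -
  a) = 1 + a / (j - a), and the 1 sums to exp (- w). The right side is opposite to that of
  \<open>exp_half_integral_recurrence\<close>, so the sum of both functions obeys the homogeneous
  recurrence, as w^a \<Gamma>(-a) does.\<close>

lemma exp_unit_series_recurrence: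
  assumes "a \<notin> \<nat>"
  shows "a * exp_unit_series a w + w * exp_unit_series (a - 1) w = - exp (- w)"
proof -
  have a1: "a - 1 \<notin> \<nat>"
    using assms Nats_add[of "a - 1" 1] by auto
  have ne: "of_nat j - a \<noteq> 0" for j using assms by auto
  have e: "(\<lambda>j. (- w) ^ j / fact j) sums exp (- w)"
    using exp_converges[of "- w"] by (simp add: scaleR_conv_of_real divide_inverse mult.commute)
  have s: "(\<lambda>j. a * ((- w) ^ j / (fact j * (of_nat j - a)))) sums (a * exp_unit_series a w)"
    unfolding exp_unit_series_def by (intro sums_mult summable_sums summable_exp_unit_series assms)
  have "(\<lambda>j. - w * ((- w) ^ j / (fact j * (of_nat j - (a - 1))))) sums (- w * exp_unit_series (a - 1) w)"
    unfolding exp_unit_series_def by (intro sums_mult summable_sums summable_exp_unit_series a1)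
  also have "(\<lambda>j. - w * ((- w) ^ j / (fact j * (of_nat j - (a - 1)))))
    = (\<lambda>j. (- w) ^ Suc j / fact (Suc j) * (of_nat (Suc j) / (of_nat (Suc j) - a)))"
  proof
    fix j
    have "of_nat (Suc j) \<noteq> (0 :: complex)" by (simp del: of_nat_Suc)
    moreover have "of_nat j - (a - 1) = of_nat (Suc j) - a" by simp
    ultimately show "- w * ((- w) ^ j / (fact j * (of_nat j - (a - 1))))
      = (- w) ^ Suc j / fact (Suc j) * (of_nat (Suc j) / (of_nat (Suc j) - a))"
      by (simp add: fact_Suc del: of_nat_Suc)
  qed
  \<comment> \<open>The sum over \<open>Suc j\<close> extends to j = 0 without change because the
    factor j makes that term vanish.\<close>
  finally have "(\<lambda>j. (- w) ^ j / fact j * (of_nat j / (of_nat j - a))) sums (- w * exp_unit_series (a - 1) w)"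
    by (subst (asm) sums_Suc_iff) simp
  also have "(\<lambda>j. (- w) ^ j / fact j * (of_nat j / (of_nat j - a)))
    = (\<lambda>j. (- w) ^ j / fact j + a * ((- w) ^ j / (fact j * (of_nat j - a))))"
    using ne by (simp add: fun_eq_iff field_simps)
  finally have "- w * exp_unit_series (a - 1) w = exp (- w) + a * exp_unit_series a w"
    using sums_unique2 sums_add[OF e s] by blast
  then show ?thesis by algebra
qed

lemma
  fixes a :: complex
  assumes "Re a < 0"
  shows set_integrable_exp_half_line: "set_integrable lborel {0<..} (\<lambda>x. exp (a * of_real x))"
    and set_integral_exp_half_line: "(LBINT x:{0<..}. exp (a * of_real x)) = - 1 / a"
proof -
  have "set_integrable lborel {0<..} (\<lambda>x. exp (Re a * x))"
  proof -
    have "(\<lambda>x. exp (- (- Re a) * x)) absolutely_integrable_on {0..}"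
      using assms by (intro nonnegative_absolutely_integrable_1 integrable_on_exp_minus_to_infinity) auto
    then have "(\<lambda>x. exp (Re a * x)) absolutely_integrable_on {0..}" by simp
    then have "(\<lambda>x. exp (Re a * x)) absolutely_integrable_on {0<..}"
      by (rule set_integrable_subset) auto
    then show ?thesis
      unfolding set_integrable_def by (subst (asm) integrable_completion) auto
  qed
  then show *: "set_integrable lborel {0<..} (\<lambda>x. exp (a * of_real x))"
    by (rule set_integrable_bound) (auto simp: set_borel_measurable_def)
  have "(LBINT x:{0<..}. exp (a * of_real x)) = 0 - exp (a * of_real 0) / a"
  proof (rule integral_FTC_greaterThan[where F = "\<lambda>x. exp (a * of_real x) / a"])
    have "a \<noteq> 0" using assms by auto
    show "((\<lambda>x. exp (a * of_real x) / a) has_vector_derivative exp (a * of_real x)) (at x)" for x :: real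
    proof -
      have "((\<lambda>z. exp (a * z) / a) has_field_derivative exp (a * of_real x)) (at (of_real x))"
        using \<open>a \<noteq> 0\<close> by (auto intro!: derivative_eq_intros)
      from has_vector_derivative_real_field[OF this] show ?thesis by simp
    qed
    have "((\<lambda>x. exp (Re a * x)) \<longlongrightarrow> 0) at_top" using assms by real_asymp
    then have "((\<lambda>x. norm (exp (a * complex_of_real x))) \<longlongrightarrow> 0) at_top" by simp
    then have "((\<lambda>x. exp (a * complex_of_real x)) \<longlongrightarrow> 0) at_top"
      by (rule tendsto_norm_zero_cancel)
    then show "((\<lambda>x. exp (a * complex_of_real x) / a) \<longlongrightarrow> 0) at_top"
      by (rule tendsto_divide_zero)
  qed (use * in \<open>auto intro!: continuous_intros\<close>)
  then show "(LBINT x:{0<..}. exp (a * of_real x)) = - 1 / a" by simp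
qed

text \<open>Termwise integration is legitimate because |exp (- k x)| \<le> 1 on the half-line, so
  the k-th term is at most |\<phi>| |w|^k / k!. It is applied with \<phi>(x) = exp (a x) and with
  \<phi>(x) = exp (- \<nu> x - w exp x).\<close>

lemma sums_set_integral_mult_exp_exp:
  fixes \<phi> :: "real \<Rightarrow> complex"
  assumes \<phi>: "set_integrable lborel {0<..} \<phi>"
  shows "(\<lambda>k. (- w) ^ k / fact k * (LBINT x:{0<..}. \<phi> x * exp (- of_nat k * of_real x))) sums
           (LBINT x:{0<..}. \<phi> x * exp (- w * of_real (exp (- x))))"
proof -
  let ?\<psi> = "\<lambda>x. indicator {0<..} x *\<^sub>R \<phi> x"
  let ?g = "\<lambda>k x. (- w) ^ k / fact k * (?\<psi> x * exp (- of_nat k * of_real x))"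
  have \<psi>: "integrable lborel ?\<psi>" using \<phi> by (simp add: set_integrable_def)
  have summand: "?g k x = ?\<psi> x * ((- w * of_real (exp (- x))) ^ k /\<^sub>R fact k)" for k x
  proof -
    have "exp (- of_nat k * of_real x) = exp (of_nat k * complex_of_real (- x))"
      by simp
    also have "\<dots> = complex_of_real (exp (- x)) ^ k"
      by (simp only: exp_of_nat_mult exp_of_real)
    finally show ?thesis
      by (simp only: power_mult_distrib scaleR_conv_of_real) (simp add: field_simps)
  qed
  have sums: "(\<lambda>k. ?g k x) sums (?\<psi> x * exp (- w * of_real (exp (- x))))" for x
    unfolding summand by (intro sums_mult exp_converges)
  have bound: "norm (?g k x) \<le> norm (?\<psi> x) * (norm w ^ k /\<^sub>R fact k)" for k x
  proof (cases "x > 0")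
    case True
    then show ?thesis
      by (auto simp: norm_mult norm_power norm_inverse divide_inverse mult_ac intro!: mult_left_mono mult_left_le)
  qed simp
  have int: "integrable lborel (?g k)" for k
  proof (rule Bochner_Integration.integrable_bound)
    show "integrable lborel (\<lambda>x. norm (?\<psi> x) * (norm w ^ k /\<^sub>R fact k))"
      using \<psi> by (intro integrable_mult_left integrable_norm)
    show "AE x in lborel. norm (?g k x) \<le> norm (norm (?\<psi> x) * (norm w ^ k /\<^sub>R fact k))"
      by (intro AE_I2 order_trans[OF bound]) simp
  qed (use borel_measurable_integrable[OF \<psi>] in measurable)
  have "(\<lambda>k. LBINT x. ?g k x) sums (LBINT x. (\<Sum>k. ?g k x))"
  proof (rule sums_integral[OF int])
    have exp: "summable (\<lambda>k. c * (norm w ^ k /\<^sub>R fact k))" for c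
      by (intro summable_mult summable_exp_generic)
    show "AE x in lborel. summable (\<lambda>k. norm (?g k x))"
      by (intro AE_I2 summable_comparison_test'[OF exp, of 0]) (use bound in simp)
    show "summable (\<lambda>k. LBINT x. norm (?g k x))"
    proof (rule summable_comparison_test'[OF exp, of 0 _ "LBINT x. norm (?\<psi> x)"])
      fix k
      have "(LBINT x. norm (?g k x)) \<le> (LBINT x. norm (?\<psi> x) * (norm w ^ k /\<^sub>R fact k))"
        using bound int \<psi> by (intro integral_mono integrable_norm integrable_mult_left) auto
      also have "\<dots> = (LBINT x. norm (?\<psi> x)) * (norm w ^ k /\<^sub>R fact k)"
        by (rule integral_mult_left_zero)
      finally show "norm (LBINT x. norm (?g k x)) \<le> (LBINT x. norm (?\<psi> x)) * (norm w ^ k /\<^sub>R fact k)"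
        by simp
    qed
  qed
  then show ?thesis
    unfolding sums_unique[OF sums, symmetric]
    by (simp only: set_lebesgue_integral_def mult_scaleR_left integral_mult_right_zero)
qed

text \<open>This is the reflected part over x < 0 of the Gamma integral on the line. Its terms exp
  ((a - j) x) decay and integrate to 1 / (j - a).\<close>

lemma set_integral_exp_minus_exp_neg:
  fixes a w :: complex
  assumes "Re a < 0"
  shows "(LBINT x:{0<..}. exp (a * of_real x - w * of_real (exp (- x)))) = exp_unit_series a w"
proof -
  have "(LBINT x:{0<..}. exp (a * of_real x) * exp (- of_nat j * of_real x)) = 1 / (of_nat j - a)" for j
  proof -
    have neg: "Re (a - of_nat j) < 0" using assms by simp
    have "(LBINT x:{0<..}. exp (a * of_real x) * exp (- of_nat j * of_real x))
        = (LBINT x:{0<..}. exp ((a - of_nat j) * of_real x))"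
      by (simp add: algebra_simps flip: exp_add)
    also have "\<dots> = - 1 / (a - of_nat j)" by (rule set_integral_exp_half_line[OF neg])
    also have "\<dots> = 1 / (of_nat j - a)" using neg by (auto simp: divide_simps)
    finally show ?thesis .
  qed
  then have "(\<lambda>j. (- w) ^ j / fact j * (1 / (of_nat j - a))) sums
      (LBINT x:{0<..}. exp (a * of_real x) * exp (- w * of_real (exp (- x))))"
    using sums_set_integral_mult_exp_exp[OF set_integrable_exp_half_line[OF assms], of w] by simp
  then show ?thesis
    unfolding exp_unit_series_def by (simp add: sums_iff flip: exp_add)
qed

text \<open>For Re a < 0 the formula comes from splitting the Gamma integral over the line at 0. The
  recurrences then carry it one unit strip to the right at a time, since both sides obey the same
  one.\<close>

theorem exp_half_integral_eq:
  assumes w: "Re w > 0" and "a \<notin> \<nat>"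
  shows "exp_half_integral a w = w powr a * Gamma (- a) - exp_unit_series a w"
proof -
  have base: "exp_half_integral a w = w powr a * Gamma (- a) - exp_unit_series a w" if "Re a < 0" for a
  proof -
    let ?f = "\<lambda>x. exp (- a * of_real x - w * of_real (exp x))"
    have "w powr a * Gamma (- a) = (LBINT x. ?f x)"
      using integral_exp_minus_exp[of "- a" w] that w by simp
    also have "\<dots> = (LBINT x:{0<..}. ?f x) + (LBINT x:{0<..}. ?f (- x))"
      using that w by (intro integral_eq_half_line integrable_exp_minus_exp) auto
    also have "\<dots> = exp_half_integral a w + exp_unit_series a w"
      using set_integral_exp_minus_exp_neg[OF that, of w] by (simp add: exp_half_integral_def)
    finally show ?thesis by simp
  qed
  have "Re a < real n \<Longrightarrow> a \<notin> \<nat> \<Longrightarrow>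
      exp_half_integral a w = w powr a * Gamma (- a) - exp_unit_series a w" for n
  proof (induction n arbitrary: a)
    case 0
    then show ?case using base by simp
  next
    case (Suc n)
    have "a \<noteq> 0" "w \<noteq> 0" using Suc.prems w by auto
    have "a - 1 \<notin> \<nat>" using Suc.prems Nats_add[of "a - 1" 1] by auto
    with Suc have IH: "exp_half_integral (a - 1) w
        = w powr (a - 1) * Gamma (- (a - 1)) - exp_unit_series (a - 1) w" by simp
    have "Gamma (- a + 1) = - a * Gamma (- a)"
      using \<open>a \<notin> \<nat>\<close> by (intro Gamma_plus1) (auto elim!: nonpos_Ints_cases')
    then have "w * (w powr (a - 1) * Gamma (- (a - 1))) = - a * (w powr a * Gamma (- a))"
      using \<open>w \<noteq> 0\<close> by (simp add: powr_diff)
    \<comment> \<open>The terms exp (- w) of the two recurrences cancel. As a is not a natural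
      number, the common factor a can be removed afterwards.\<close>
    then have "a * exp_half_integral a w = a * (w powr a * Gamma (- a) - exp_unit_series a w)"
      using exp_half_integral_recurrence[OF w, of a] exp_unit_series_recurrence[OF Suc.prems(2), of w]
      unfolding IH by (simp add: algebra_simps)
    then show ?case using \<open>a \<noteq> 0\<close> by simp
  qed
  moreover obtain n where "Re a < real n" using reals_Archimedean2 by blast
  ultimately show ?thesis using assms by blast
qed

section \<open>Expansion of the half-line integral in Bessel terms\<close>

text \<open>Each term of the termwise integration is an incomplete Gamma integral at \<nu> + k,
  whose Gamma part turns into a term of \<open>bessel_I\<close>. Both parts stay in one series,
  since at this point only the convergence of the whole is known.\<close>

lemma sums_bessel_I_terms:
  fixes \<nu> t :: complex
  assumes t: "Re t > 0" and \<nu>: "\<nu> \<notin> \<int>"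
  defines "h \<equiv> (LBINT x:{0<..}. exp (- \<nu> * of_real x - t * of_real (cosh x)))"
  shows "(\<lambda>k. - (of_real pi / sin (of_real pi * \<nu>)) *
             (rGamma (of_nat k + \<nu> + 1) / fact k * (t / 2) powr (2 * of_nat k + \<nu>))
           - (- (t / 2)) ^ k / fact k * exp_unit_series (\<nu> + of_nat k) (t / 2)) sums h"
proof -
  define w where "w = t / 2"
  have w: "Re w > 0" "w \<noteq> 0" using t by (auto simp: w_def)
  let ?\<phi> = "\<lambda>x. exp (- \<nu> * of_real x - w * of_real (exp x))"
  have half: "(LBINT x:{0<..}. ?\<phi> x * exp (- of_nat k * of_real x)) = exp_half_integral (\<nu> + of_nat k) w" for k
    unfolding exp_half_integral_def by (simp add: algebra_simps flip: exp_add)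
  have h: "h = (LBINT x:{0<..}. ?\<phi> x * exp (- w * of_real (exp (- x))))"
    unfolding h_def w_def by (simp add: cosh_def algebra_simps flip: exp_add)
  have "(\<lambda>k. (- w) ^ k / fact k * exp_half_integral (\<nu> + of_nat k) w) sums h"
    unfolding h half[symmetric]
    by (intro sums_set_integral_mult_exp_exp set_integrable_exp_minus_exp w)
  also have "(\<lambda>k. (- w) ^ k / fact k * exp_half_integral (\<nu> + of_nat k) w) =
    (\<lambda>k. - (of_real pi / sin (of_real pi * \<nu>)) *
             (rGamma (of_nat k + \<nu> + 1) / fact k * w powr (2 * of_nat k + \<nu>))
           - (- w) ^ k / fact k * exp_unit_series (\<nu> + of_nat k) w)"
  proof
    fix k :: nat
    have nonint: "\<nu> + of_nat k \<notin> \<int>" using \<nu> Ints_diff[of "\<nu> + of_nat k" "of_nat k"] by auto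
    then have nonnat: "\<nu> + of_nat k \<notin> \<nat>" using Nats_subset_Ints by blast
    have "\<nu> + of_nat k + 1 \<notin> \<int>\<^sub>\<le>\<^sub>0"
      using nonint Ints_diff[of "\<nu> + of_nat k + 1" 1] nonpos_Ints_Int by auto
    then have "Gamma (\<nu> + of_nat k + 1) \<noteq> 0" by (simp add: Gamma_eq_zero_iff)
    \<comment> \<open>Reflection is applied at - (\<nu> + k). Removing k \<pi> from the sine costs
      (-1)^k, which later cancels the sign in (-w)^k.\<close>
    moreover have "Gamma (- (\<nu> + of_nat k)) * Gamma (\<nu> + of_nat k + 1)
        = of_real pi / sin (of_real pi * (- (\<nu> + of_nat k)))"
      using Gamma_reflection_complex[of "- (\<nu> + of_nat k)"] by (simp add: algebra_simps)
    moreover have "sin (of_real pi * (- (\<nu> + of_nat k))) = - ((- 1) ^ k * sin (of_real pi * \<nu>))"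
    proof -
      have "complex_of_real pi * of_nat k = of_real (real k * pi)" by simp
      then have "sin (complex_of_real pi * of_nat k) = 0" "cos (complex_of_real pi * of_nat k) = (- 1) ^ k"
        by (simp_all only: sin_of_real cos_of_real sin_npi cos_npi) simp_all
      then show ?thesis by (simp only: mult_minus_right sin_minus distrib_left sin_add) simp
    qed
    ultimately have "Gamma (- (\<nu> + of_nat k))
        = of_real pi / (- ((- 1) ^ k * sin (of_real pi * \<nu>))) / Gamma (\<nu> + of_nat k + 1)"
      by (metis nonzero_mult_div_cancel_right)
    also have "\<dots> = - (of_real pi / sin (of_real pi * \<nu>)) * (- 1) ^ k * rGamma (of_nat k + \<nu> + 1)"
      by (cases "even k") (simp_all add: rGamma_inverse_Gamma divide_inverse add.commute)
    finally have "Gamma (- (\<nu> + of_nat k))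
        = - (of_real pi / sin (of_real pi * \<nu>)) * (- 1) ^ k * rGamma (of_nat k + \<nu> + 1)" .
    \<comment> \<open>One w^k comes from the exponential series and w^(\<nu>+k) from the Gamma
      integral; together they make up the power in \<open>bessel_I\<close>.\<close>
    moreover have "w powr (2 * of_nat k + \<nu>) = w ^ k * w powr (\<nu> + of_nat k)"
    proof -
      have "2 * of_nat k + \<nu> = of_nat k + (\<nu> + of_nat k)" by simp
      then show ?thesis using w(2) by (simp only: powr_add powr_nat') simp
    qed
    moreover have "(- w) ^ k * (- 1) ^ k = w ^ k"
      by (simp flip: power_mult_distrib)
    ultimately show "(- w) ^ k / fact k * exp_half_integral (\<nu> + of_nat k) w =
      - (of_real pi / sin (of_real pi * \<nu>)) *
             (rGamma (of_nat k + \<nu> + 1) / fact k * w powr (2 * of_nat k + \<nu>))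
           - (- w) ^ k / fact k * exp_unit_series (\<nu> + of_nat k) w"
      unfolding exp_half_integral_eq[OF w(1) nonnat] by (simp add: algebra_simps)
  qed
  finally show ?thesis by (simp only: w_def)
qed

text \<open>The terms (-w)^(j+k) / (j! k! (j - k - \<nu>)) change sign when \<nu> becomes -\<nu> and
  j, k are exchanged. As \<nu> has positive distance from the integers, the double series is
  absolutely summable and the exchange is allowed; for its sake \<open>D\<close> is an unordered
  sum.\<close>

lemma exp_unit_series_antisymmetric:
  fixes \<nu> w :: complex
  assumes "\<nu> \<notin> \<int>"
  defines "D \<equiv> (\<lambda>\<nu>. \<Sum>\<^sub>\<infinity>k. (- w) ^ k / fact k * exp_unit_series (\<nu> + of_nat k) w)"
  shows "(\<lambda>k. (- w) ^ k / fact k * exp_unit_series (\<nu> + of_nat k) w) sums D \<nu>"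
    and "D (- \<nu>) = - D \<nu>"
proof -
  define A where "A = (\<lambda>\<nu> k j. (- w) ^ k / fact k * ((- w) ^ j / (fact j * (of_nat j - (\<nu> + of_nat k)))))"
  have sumA: "(\<lambda>(k, j). A \<nu> k j) summable_on UNIV \<times> UNIV"
    and unit: "(- w) ^ k / fact k * exp_unit_series (\<nu> + of_nat k) w = (\<Sum>\<^sub>\<infinity>j. A \<nu> k j)"
    if "\<nu> \<notin> \<int>" for \<nu> k
  proof -
    have "\<exists>d>0. \<forall>x\<in>\<int>. d \<le> dist \<nu> x"
      using separate_point_closed[OF closed_Ints that] .
    then obtain d where d: "d > 0" "\<And>x. x \<in> \<int> \<Longrightarrow> d \<le> norm (\<nu> - x)" by (auto simp: dist_norm)
    have exp: "summable (\<lambda>j. norm w ^ j / fact j)"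
      using summable_exp_generic[of "norm w"] by (simp add: divide_inverse mult.commute)
    then have exp_on: "(\<lambda>j. norm w ^ j / fact j) summable_on UNIV"
      by (rule summable_nonneg_imp_summable_on) auto
    have bound: "norm (A \<nu> k j) \<le> (norm w ^ k / fact k / d) * (norm w ^ j / fact j)" for k j
    proof -
      have "d \<le> norm (of_nat j - (\<nu> + of_nat k))"
        using d(2)[of "of_nat j - of_nat k"] by (simp add: norm_minus_commute algebra_simps)
      then have "inverse (norm (of_nat j - (\<nu> + of_nat k))) \<le> inverse d"
        using d(1) by (intro le_imp_inverse_le)
      then have "(norm w ^ k / fact k) * (norm w ^ j / fact j) * inverse (norm (of_nat j - (\<nu> + of_nat k)))
        \<le> (norm w ^ k / fact k) * (norm w ^ j / fact j) * inverse d"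
        by (intro mult_left_mono) auto
      then show ?thesis
        by (simp add: A_def norm_mult norm_inverse norm_power divide_inverse mult_ac)
    qed
    have "(\<lambda>(k, j). (norm w ^ k / fact k / d) * (norm w ^ j / fact j)) summable_on UNIV \<times> UNIV"
    proof (rule summable_on_SigmaI)
      show "((\<lambda>j. case (k, j) of (k, j) \<Rightarrow> (norm w ^ k / fact k / d) * (norm w ^ j / fact j)) has_sum
          (norm w ^ k / fact k / d) * (\<Sum>\<^sub>\<infinity>j. norm w ^ j / fact j)) UNIV" for k
        unfolding prod.case by (intro has_sum_cmult_right has_sum_infsum exp_on)
      show "(\<lambda>k. (norm w ^ k / fact k / d) * (\<Sum>\<^sub>\<infinity>j. norm w ^ j / fact j)) summable_on UNIV"
        unfolding divide_inverse[of _ d] by (intro summable_on_cmult_left exp_on)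
    qed (use d in auto)
    then have "(\<lambda>p. norm (case p of (k, j) \<Rightarrow> A \<nu> k j)) summable_on UNIV \<times> UNIV"
      by (rule Infinite_Sum.abs_summable_on_comparison_test') (use bound in auto)
    then show "(\<lambda>(k, j). A \<nu> k j) summable_on UNIV \<times> UNIV" by (rule abs_summable_summable)
    have "\<nu> + of_nat k \<notin> \<nat>" using that Nats_subset_Ints Ints_diff[of "\<nu> + of_nat k" "of_nat k"] by auto
    then have "A \<nu> k sums ((- w) ^ k / fact k * exp_unit_series (\<nu> + of_nat k) w)"
      unfolding A_def exp_unit_series_def
      by (intro sums_mult summable_sums summable_exp_unit_series)
    \<comment> \<open>Absolute convergence identifies the ordered series in
      \<open>exp_unit_series\<close> with the unordered sum over j.\<close>
    moreover have "summable (\<lambda>j. norm (A \<nu> k j))"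
      by (rule summable_comparison_test'[OF summable_mult[OF exp, of "norm w ^ k / fact k / d"], of 0]) (use bound in simp)
    ultimately show "(- w) ^ k / fact k * exp_unit_series (\<nu> + of_nat k) w = (\<Sum>\<^sub>\<infinity>j. A \<nu> k j)"
      using norm_summable_imp_has_sum infsumI by metis
  qed
  have D: "D \<nu> = (\<Sum>\<^sub>\<infinity>k. \<Sum>\<^sub>\<infinity>j. A \<nu> k j)" if "\<nu> \<notin> \<int>" for \<nu>
    unfolding D_def using unit[OF that] by simp
  have "(\<lambda>k. (- w) ^ k / fact k * exp_unit_series (\<nu> + of_nat k) w) summable_on UNIV"
    unfolding unit[OF assms(1)] by (rule summable_on_Sigma_banach[OF sumA[OF assms(1)]])
  then show "(\<lambda>k. (- w) ^ k / fact k * exp_unit_series (\<nu> + of_nat k) w) sums D \<nu>"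
    unfolding D_def by (intro has_sum_imp_sums has_sum_infsum)
  have "A (- \<nu>) k j = - A \<nu> j k" for k j
  proof -
    have "of_nat j - (- \<nu> + of_nat k) = - (of_nat k - (\<nu> + of_nat j))" by simp
    then show ?thesis unfolding A_def by (simp only: mult_minus_right minus_divide_right) (simp add: mult_ac)
  qed
  then have "D (- \<nu>) = - (\<Sum>\<^sub>\<infinity>k. \<Sum>\<^sub>\<infinity>j. A \<nu> j k)"
    using assms(1) by (simp add: D infsum_uminus)
  also have "(\<Sum>\<^sub>\<infinity>k. \<Sum>\<^sub>\<infinity>j. A \<nu> j k) = D \<nu>"
    unfolding D[OF assms(1)] using infsum_swap_banach[OF sumA[OF assms(1)]] by simp
  finally show "D (- \<nu>) = - D \<nu>" .
qed

section \<open>The integral representation of K and its derivatives in the order\<close>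

text \<open>The fact \<open>I\<close> below expresses the Bessel function through h + D. Taken at
  \<nu> and -\<nu>, the h parts add up to the integral over the line, the D parts cancel, and the
  oddness of the sine produces the difference of the two Bessel functions.\<close>

lemma bessel_K_eq_integral_nonint:
  fixes \<nu> t :: complex
  assumes t: "Re t > 0" and \<nu>: "\<nu> \<notin> \<int>"
  shows "of_real pi / 2 * ((bessel_I (- \<nu>) t - bessel_I \<nu> t) / sin (of_real pi * \<nu>))
    = 1 / 2 * (LBINT x. exp (\<nu> * of_real x - t * of_real (cosh x)))"
proof -
  define h where "h = (\<lambda>\<nu>. LBINT x:{0<..}. exp (- \<nu> * of_real x - t * of_real (cosh x)))"
  define D where "D = (\<lambda>\<nu>. \<Sum>\<^sub>\<infinity>k. (- (t / 2)) ^ k / fact k * exp_unit_series (\<nu> + of_nat k) (t / 2))"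
  have sin: "sin (of_real pi * \<nu>) \<noteq> 0" if "\<nu> \<notin> \<int>" for \<nu> :: complex
    using that by (auto simp: sin_eq_0 mult.commute)
  have I: "of_real pi / sin (of_real pi * \<nu>) * bessel_I \<nu> t = - (h \<nu> + D \<nu>)" if "\<nu> \<notin> \<int>" for \<nu>
  proof -
    let ?c = "- (of_real pi / sin (of_real pi * \<nu>))"
    have "?c \<noteq> 0" using sin[OF that] by simp
    \<comment> \<open>Adding the series of D isolates the Bessel terms, so their convergence comes
      out here; division by the nonzero \<open>?c\<close> then identifies the sum as
      \<open>bessel_I\<close>.\<close>
    have "(\<lambda>k. ?c * (rGamma (of_nat k + \<nu> + 1) / fact k * (t / 2) powr (2 * of_nat k + \<nu>)))
        sums (h \<nu> + D \<nu>)"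
      using sums_add[OF sums_bessel_I_terms[OF t that] exp_unit_series_antisymmetric(1)[OF that, of "t / 2"]]
      by (simp add: h_def D_def)
    from sums_mult_D[OF this \<open>?c \<noteq> 0\<close>] have "bessel_I \<nu> t = (h \<nu> + D \<nu>) / ?c"
      unfolding bessel_I_def by (rule sums_unique[symmetric])
    then have "?c * bessel_I \<nu> t = h \<nu> + D \<nu>"
      using \<open>?c \<noteq> 0\<close> by simp
    then show ?thesis unfolding mult_minus_left by (metis minus_minus)
  qed
  have minus_nonint: "- \<nu> \<notin> \<int>" using \<nu> by simp
  have D_neg: "D (- \<nu>) = - D \<nu>"
    unfolding D_def by (rule exp_unit_series_antisymmetric(2)[OF \<nu>])
  have "(LBINT x. exp (\<nu> * of_real x - t * of_real (cosh x))) = h (- \<nu>) + h \<nu>"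
    using integral_eq_half_line[OF integrable_power_exp_cosh[OF t, of 0 \<nu>]] by (simp add: h_def)
  also have "\<dots> = of_real pi * ((bessel_I (- \<nu>) t - bessel_I \<nu> t) / sin (of_real pi * \<nu>))"
  proof -
    have "of_real pi * ((bessel_I (- \<nu>) t - bessel_I \<nu> t) / sin (of_real pi * \<nu>))
        = - (of_real pi / sin (of_real pi * - \<nu>) * bessel_I (- \<nu>) t)
          - of_real pi / sin (of_real pi * \<nu>) * bessel_I \<nu> t"
      by (simp add: diff_divide_distrib right_diff_distrib)
    also have "\<dots> = h (- \<nu>) + h \<nu>"
      unfolding I[OF \<nu>] I[OF minus_nonint] D_neg by simp
    finally show ?thesis by simp
  qed
  finally show ?thesis by simp
qed

text \<open>At an integer order the quotient agrees with the integral on a punctured neighbourhood,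
  and the integral is continuous in the order. Hence the limit exists and \<open>Lim\<close> in
  \<open>bessel_K\<close> takes that value.\<close>

theorem bessel_K_eq_integral:
  fixes \<nu> t :: complex
  assumes t: "Re t > 0"
  shows "bessel_K \<nu> t = 1 / 2 * (LBINT x. exp (\<nu> * of_real x - t * of_real (cosh x)))"
proof (cases "\<nu> \<in> \<int>")
  case False
  then show ?thesis using bessel_K_eq_integral_nonint[OF t] by (simp add: bessel_K_def)
next
  case True
  let ?q = "\<lambda>\<mu>. of_real pi / 2 * ((bessel_I (- \<mu>) t - bessel_I \<mu> t) / sin (of_real pi * \<mu>))"
  let ?J = "\<lambda>\<mu>. 1 / 2 * (LBINT x. exp (\<mu> * of_real x - t * of_real (cosh x)))"
  have "isCont (\<lambda>\<mu>. LBINT x. exp (\<mu> * of_real x - t * of_real (cosh x))) \<nu>"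
    using DERIV_isCont[OF has_field_derivative_integral_power_exp_cosh[OF t, of 0 \<nu>]] by simp
  then have "?J \<midarrow>\<nu>\<rightarrow> ?J \<nu>"
    unfolding isCont_def by (intro tendsto_mult tendsto_const)
  moreover have "\<forall>\<^sub>F \<mu> in at \<nu>. ?J \<mu> = ?q \<mu>"
  proof -
    \<comment> \<open>Every set of integers is closed, so removing all integers other than \<nu>
      leaves a neighbourhood of \<nu>.\<close>
    have "open (- (\<int> - {\<nu>}))"
      by (intro open_Compl closed_subset_Ints) auto
    then have "\<forall>\<^sub>F \<mu> in at \<nu>. \<mu> \<in> - (\<int> - {\<nu>}) - {\<nu>}"
      by (rule eventually_at_in_open) auto
    then show ?thesis
      by eventually_elim (use bessel_K_eq_integral_nonint[OF t] in auto)
  qed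
  ultimately have "?q \<midarrow>\<nu>\<rightarrow> ?J \<nu>"
    by (rule Lim_transform_eventually)
  then show ?thesis
    using True by (simp add: bessel_K_def tendsto_Lim)
qed

theorem mainTheorem4:
  fixes n :: nat and \<nu> :: real and t :: complex
  assumes "Re t > 0"
  defines "K \<equiv> (\<lambda>\<mu>::real. bessel_K (of_real \<mu>) t)"
    and "f \<equiv> (\<lambda>x::real. of_real (x ^ n) * exp (- t * of_real (cosh x)) *
               (of_real (exp (\<nu> * x)) + (-1) ^ n * of_real (exp (- \<nu> * x))) :: complex)"
    and "g \<equiv> (\<lambda>x::real. of_real (x ^ n) * exp (of_real (\<nu> * x) - t * of_real (cosh x)) :: complex)"
  shows "(\<forall>k<n. \<forall>\<mu>. iter_vector_derivative k K differentiable (at \<mu>)) \<and>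
         set_integrable lborel {0..} f \<and>
         integrable lborel g \<and>
         iter_vector_derivative n K \<nu> = 1 / 2 * (LBINT x:{0..}. f x) \<and>
         1 / 2 * (LBINT x:{0..}. f x) = 1 / 2 * (LBINT x. g x)"
proof -
  let ?J = "\<lambda>k \<mu>. LBINT x. of_real (x ^ k) * exp (\<mu> * of_real x - t * of_real (cosh x))"
  \<comment> \<open>The complex derivative in the order, restricted to real \<mu>, gives the
    derivative along the real line.\<close>
  have deriv: "((\<lambda>\<mu>. 1 / 2 * ?J k (of_real \<mu>)) has_vector_derivative 1 / 2 * ?J (Suc k) (of_real \<mu>)) (at \<mu>)" for k \<mu>
    using has_vector_derivative_real_field[OF
        has_field_derivative_integral_power_exp_cosh[OF assms(1), of k "of_real \<mu>"]]
    by (intro has_vector_derivative_mult_right)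
  \<comment> \<open>Stated as an equality of functions, so that the induction step can differentiate
    at every \<mu>.\<close>
  have iter: "iter_vector_derivative k K = (\<lambda>\<mu>. 1 / 2 * ?J k (of_real \<mu>))" for k
  proof (induction k)
    case 0
    show ?case
      unfolding iter_vector_derivative_def K_def bessel_K_eq_integral[OF assms(1)] by simp
  next
    case (Suc k)
    have "iter_vector_derivative (Suc k) K = (\<lambda>\<mu>. vector_derivative (iter_vector_derivative k K) (at \<mu>))"
      by (simp add: iter_vector_derivative_def)
    also have "\<dots> = (\<lambda>\<mu>. 1 / 2 * ?J (Suc k) (of_real \<mu>))"
      unfolding Suc.IH using vector_derivative_at[OF deriv] by blast
    finally show ?case .
  qed
  \<comment> \<open>With every iterate differentiable, no \<open>vector_derivative\<close> in the
    iteration takes an unspecified value.\<close>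
  have diff: "iter_vector_derivative k K differentiable (at \<mu>)" for k \<mu>
    unfolding iter using deriv by (rule differentiableI_vector)
  have g_eq: "g = (\<lambda>x. of_real (x ^ n) * exp (of_real \<nu> * of_real x - t * of_real (cosh x)))"
    by (simp add: g_def)
  have int_g: "integrable lborel g"
    unfolding g_eq by (rule integrable_power_exp_cosh[OF assms(1)])
  have int_g': "integrable lborel (\<lambda>x. g (- x))"
    using lborel_integrable_real_affine[OF int_g, of "-1" 0] by simp
  \<comment> \<open>Since cosh is even and (-x)^n = (-1)^n x^n, the reflected g(-x) supplies the
    second exponential of f.\<close>
  have f_eq: "f = (\<lambda>x. g x + g (- x))"
    by (simp add: f_def g_def fun_eq_iff exp_diff exp_minus power_minus[of "of_real _ :: complex"] field_simps
        flip: exp_of_real)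
  have int_f: "set_integrable lborel {0..} f"
    unfolding set_integrable_def f_eq
    by (intro integrable_mult_indicator Bochner_Integration.integrable_add int_g int_g') auto
  have set_int: "set_integrable lborel {0<..} g" "set_integrable lborel {0<..} (\<lambda>x. g (- x))"
    unfolding set_integrable_def using int_g int_g' by (auto intro: integrable_mult_indicator)
  have [measurable]: "g \<in> borel_measurable borel" using int_g by auto
  \<comment> \<open>The endpoint 0 is a null set.\<close>
  have "(LBINT x:{0..}. f x) = (LBINT x:{0<..}. f x)"
    unfolding set_lebesgue_integral_def f_eq
    by (rule integral_cong_AE)
      (use AE_lborel_singleton[of 0] in \<open>auto elim!: eventually_mono split: split_indicator\<close>)
  also have "\<dots> = (LBINT x. g x)"
    unfolding f_eq integral_eq_half_line[OF int_g] by (rule set_integral_add(2)[OF set_int])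
  finally have "(LBINT x:{0..}. f x) = (LBINT x. g x)" .
  moreover have "iter_vector_derivative n K \<nu> = 1 / 2 * (LBINT x. g x)"
    unfolding iter g_eq ..
  ultimately show ?thesis
    using diff int_f int_g by simp
qed

end
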